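(* Let $N, L, M \ge 1$ be integers and let $f_{ij} \in \mathbb{C}^N$ for $1 \le i \le L$, $1 \le j \le M$. For each $i = 1,\dots,L$ put $W_i := \operatorname{span}\{f_{ij}\}_{j=1}^M$. Suppose that: (1) there is an index $i_0 \in \{1,\dots,L\}$ such that $\{f_{i_0 j}\}_{j=1}^M$ is a $B$-tight frame for $W_{i_0}$, for some $B>0$; (2) there are coisometries $\mathcal{U}_1,\dots,\mathcal{U}_L : \mathbb{C}^N \to \mathbb{C}^N$ such that $f_{ij} = \mathcal{U}_i f_{i_0 j}$ for all $i=1,\dots,L$ and $j=1,\dots,M$; (3) for every $j=1,\dots,M$, the family $\{f_{ij}\}_{i=1}^L$ is an $A_j$-tight frame for $\mathbb{C}^N$, for some $A_j>0$. Then $\{(W_i,1)\}_{i=1}^L$ (the subspaces $W_i$, all with weight $1$) is a tight fusion frame for $\mathbb{C}^N$.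
   Context: $\mathbb{C}^N$ carries its standard inner product. A finite family $\{g_k\}_k$ of vectors in a finite-dimensional inner product space $V$ is a $C$-tight frame for $V$ (with $C>0$) if $\sum_k |\langle x, g_k\rangle|^2 = C\|x\|^2$ for all $x \in V$. A coisometry is a linear operator $\mathcal{U}$ with $\mathcal{U}\mathcal{U}^* = I$, i.e. $\|\mathcal{U}^*x\| = \|x\|$ for all $x$. A finite family of subspaces $\{W_i\}$ of $\mathbb{C}^N$, all with weight $1$, with orthogonal projections $P_i$ of $\mathbb{C}^N$ onto $W_i$, is a tight fusion frame for $\mathbb{C}^N$ if there is a constant $A>0$ such that $\sum_i \|P_i x\|^2 = A\|x\|^2$ for all $x \in \mathbb{C}^N$. *)

theory Defs
  imports "HOL-Analysis.Analysis"
begin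

text \<open>The inner product that the library puts on \<^typ>\<open>complex ^ 'n\<close> is the real one, the
  real part of the standard Hermitian inner product below. The norms agree.\<close>

definition hinner :: "complex ^ 'n \<Rightarrow> complex ^ 'n \<Rightarrow> complex"
  where "hinner x y = (\<Sum>k\<in>UNIV. x $ k * cnj (y $ k))"

lemma hinner_self: "hinner x x = of_real ((norm x)\<^sup>2)"
  by (simp add: hinner_def norm_vec_def L2_set_def complex_norm_square sum_nonneg del: of_real_power)

lemma Re_hinner: "Re (hinner x y) = x \<bullet> y"
  by (simp add: hinner_def inner_vec_def inner_complex_def)

lemma hinner_diff_left: "hinner (x - y) z = hinner x z - hinner y z"
  by (simp add: hinner_def left_diff_distrib sum_subtractf)

lemma hinner_scale_right: "hinner x (c *s y) = cnj c * hinner x y"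
  by (simp add: hinner_def sum_distrib_left mult_ac)

lemma hinner_eq_zero_iff: "hinner x x = 0 \<longleftrightarrow> x = 0"
  by (simp add: hinner_self)

definition tight_frame ::
    "'i set \<Rightarrow> ('i \<Rightarrow> complex ^ 'n) \<Rightarrow> (complex ^ 'n) set \<Rightarrow> real \<Rightarrow> bool"
  where "tight_frame I g V C \<longleftrightarrow>
    finite I \<and> vec.subspace V \<and> (\<forall>k\<in>I. g k \<in> V) \<and> C > 0 \<and>
    (\<forall>x\<in>V. (\<Sum>k\<in>I. (cmod (hinner x (g k)))\<^sup>2) = C * (norm x)\<^sup>2)"

definition hadjoint :: "(complex ^ 'n \<Rightarrow> complex ^ 'n) \<Rightarrow> complex ^ 'n \<Rightarrow> complex ^ 'n"
  where "hadjoint U = (SOME V. \<forall>x y. hinner (U x) y = hinner x (V y))"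

lemma hadjoint_works:
  fixes U :: "complex ^ 'n \<Rightarrow> complex ^ 'n"
  assumes "Vector_Spaces.linear (*s) (*s) U"
  shows "hinner (U x) y = hinner x (hadjoint U y)"
proof -
  define V where "V = (\<lambda>y. \<chi> k. \<Sum>l\<in>UNIV. cnj (matrix U $ l $ k) * y $ l)"
  have U: "U x = matrix U *v x" for x
    using matrix_works[OF assms] by simp
  have "hinner (U x) y = hinner x (V y)" for x y
  proof -
    have "hinner (U x) y = (\<Sum>l\<in>UNIV. \<Sum>k\<in>UNIV. matrix U $ l $ k * x $ k * cnj (y $ l))"
      by (subst U) (simp add: hinner_def matrix_vector_mult_def sum_distrib_right)
    also have "\<dots> = (\<Sum>k\<in>UNIV. \<Sum>l\<in>UNIV. matrix U $ l $ k * x $ k * cnj (y $ l))"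
      by (rule sum.swap)
    also have "\<dots> = hinner x (V y)"
      by (simp add: V_def hinner_def sum_distrib_left mult.left_commute mult.assoc)
    finally show ?thesis .
  qed
  then have "\<forall>x y. hinner (U x) y = hinner x (hadjoint U y)"
    unfolding hadjoint_def by (intro someI[where x = V and P = "\<lambda>V. \<forall>x y. hinner (U x) y = hinner x (V y)"]) blast
  then show ?thesis by blast
qed

definition coisometry :: "(complex ^ 'n \<Rightarrow> complex ^ 'n) \<Rightarrow> bool"
  where "coisometry U \<longleftrightarrow> Vector_Spaces.linear (*s) (*s) U \<and> U \<circ> hadjoint U = id"

definition orth_proj :: "(complex ^ 'n) set \<Rightarrow> complex ^ 'n \<Rightarrow> complex ^ 'n"
  where "orth_proj W x = (THE p. p \<in> W \<and> (\<forall>w\<in>W. hinner (x - p) w = 0))"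

lemma orth_proj_works:
  fixes W :: "(complex ^ 'n) set"
  assumes W: "vec.subspace W"
  shows "orth_proj W x \<in> W \<and> (\<forall>w\<in>W. hinner (x - orth_proj W x) w = 0)"
  unfolding orth_proj_def
proof (rule theI')
  have scaleR: "r *\<^sub>R v = complex_of_real r *s v" for r and v :: "complex ^ 'n"
    by (simp add: vec_eq_iff scaleR_conv_of_real[where ?'a = complex])
  have "subspace W"
    unfolding real_vector.subspace_def scaleR
    using W by (auto simp: vec.subspace_def)
  then have span: "span W = W" by (simp add: span_eq_iff)
  obtain y z where y: "y \<in> span W" and z: "\<And>w. w \<in> span W \<Longrightarrow> orthogonal z w"
    and x: "x = y + z"
    using orthogonal_subspace_decomp_exists[of W x] by metis
  have "hinner z w = 0" if w: "w \<in> W" for w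
  proof -
    have "\<i> *s w \<in> W" using w W by (simp add: vec.subspace_def)
    then have "Re (hinner z (\<i> *s w)) = 0" "Re (hinner z w) = 0"
      using z w unfolding span Re_hinner orthogonal_def by auto
    then show ?thesis
      unfolding hinner_scale_right by (simp add: complex_eq_iff)
  qed
  then have ex: "y \<in> W \<and> (\<forall>w\<in>W. hinner (x - y) w = 0)"
    using y x span by simp
  show "\<exists>!p. p \<in> W \<and> (\<forall>w\<in>W. hinner (x - p) w = 0)"
  proof (rule ex1I[where a = y], rule ex)
    fix p assume p: "p \<in> W \<and> (\<forall>w\<in>W. hinner (x - p) w = 0)"
    have "p - y \<in> W" using p ex W by (simp add: vec.subspace_diff)
    then have "hinner (x - y) (p - y) - hinner (x - p) (p - y) = 0"
      using p ex by simp
    then have "hinner (p - y) (p - y) = 0"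
      by (simp add: hinner_diff_left)
    then show "p = y" by (simp add: hinner_eq_zero_iff)
  qed
qed

text \<open>All weights of the fusion frame are \<open>1\<close>.\<close>

definition tight_fusion_frame :: "'i set \<Rightarrow> ('i \<Rightarrow> (complex ^ 'n) set) \<Rightarrow> bool"
  where "tight_fusion_frame I W \<longleftrightarrow>
    finite I \<and> (\<forall>i\<in>I. vec.subspace (W i)) \<and>
    (\<exists>A>0. \<forall>x. (\<Sum>i\<in>I. (norm (orth_proj (W i) x))\<^sup>2) = A * (norm x)\<^sup>2)"

end

theory Submission imports Defs begin

text \<open>In finite dimension a coisometry is unitary, so it carries the \<open>B\<close>-tight frame of
  \<open>W\<^bsub>i0\<^esub>\<close> to a \<open>B\<close>-tight frame of \<open>W\<^sub>i\<close>, and \<open>\<Sum>\<^sub>j |\<langle>x, f\<^sub>i\<^sub>j\<rangle>|\<^sup>2 = B \<parallel>P\<^sub>i x\<parallel>\<^sup>2\<close> for every \<open>x\<close>.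
  Summing over \<open>i\<close> and exchanging the sums gives the fusion frame bound \<open>(\<Sum>\<^sub>j A\<^sub>j) / B\<close>.\<close>

lemma coisometry_linear: "coisometry U \<Longrightarrow> Vector_Spaces.linear (*s) (*s) U"
  by (simp add: coisometry_def)

text \<open>\<open>hadjoint U\<close> is a right inverse of \<open>U\<close>, so \<open>U\<close> is
  surjective, hence injective by finite dimension. Injectivity makes \<open>hadjoint U\<close> a
  left inverse too, and moving \<open>U\<close> across the inner product then cancels it.\<close>

lemma coisometry_hinner:
  assumes "coisometry U"
  shows "hinner (U x) (U y) = hinner x y"
proof -
  note lin = coisometry_linear[OF assms]
  have right_inv: "U (hadjoint U z) = z" for z
    using assms by (metis coisometry_def comp_apply id_apply)
  then have "surj U"
    by (rule surjI)
  then have "inj U"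
    using vec.linear_surj_imp_inj[OF lin] by blast
  then have "hadjoint U (U y) = y"
    using right_inv by (rule injD)
  then show ?thesis
    using hadjoint_works[OF lin] by simp
qed

lemma coisometry_norm:
  assumes "coisometry U"
  shows "norm (U x) = norm x"
  using coisometry_hinner[OF assms, of x x] by (simp add: hinner_self del: of_real_power)

lemma tight_frame_coisometry:
  assumes "tight_frame I g V C" and "coisometry U"
  shows "tight_frame I (\<lambda>k. U (g k)) (U ` V) C"
  using assms coisometry_linear[OF assms(2)]
  by (auto simp: tight_frame_def coisometry_hinner coisometry_norm intro: vec.linear_subspace_image)

text \<open>The residual \<open>x - orth_proj V x\<close> is orthogonal to every \<open>g k\<close>,
  so \<open>x\<close> and its projection have the same frame coefficients. This extends the frame
  identity from \<open>V\<close> to all \<open>x\<close>.\<close>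

lemma tight_frame_orth_proj:
  assumes "tight_frame I g V C"
  shows "(\<Sum>k\<in>I. (cmod (hinner x (g k)))\<^sup>2) = C * (norm (orth_proj V x))\<^sup>2"
proof -
  have V: "vec.subspace V" and g: "\<And>k. k \<in> I \<Longrightarrow> g k \<in> V"
    using assms by (auto simp: tight_frame_def)
  have "hinner x (g k) = hinner (orth_proj V x) (g k)" if "k \<in> I" for k
    using orth_proj_works[OF V, of x] g[OF that] by (auto simp: hinner_diff_left)
  then have "(\<Sum>k\<in>I. (cmod (hinner x (g k)))\<^sup>2) = (\<Sum>k\<in>I. (cmod (hinner (orth_proj V x) (g k)))\<^sup>2)"
    by simp
  then show ?thesis
    using assms orth_proj_works[OF V, of x] by (simp add: tight_frame_def)
qed

theorem proposition4p1:
  fixes f :: "nat \<Rightarrow> nat \<Rightarrow> complex ^ 'n"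
    and W :: "nat \<Rightarrow> (complex ^ 'n) set"
    and L M i0 :: nat
  assumes "L \<ge> 1" and "M \<ge> 1"
    and "\<And>i. i \<in> {1..L} \<Longrightarrow> W i = vec.span (f i ` {1..M})"
    and "i0 \<in> {1..L}"
    and "\<exists>B>0. tight_frame {1..M} (f i0) (W i0) B"
    and "\<exists>U. \<forall>i\<in>{1..L}. coisometry (U i) \<and> (\<forall>j\<in>{1..M}. f i j = U i (f i0 j))"
    and "\<And>j. j \<in> {1..M} \<Longrightarrow> \<exists>A>0. tight_frame {1..L} (\<lambda>i. f i j) UNIV A"
  shows "tight_fusion_frame {1..L} W"
proof -
  obtain B where "B > 0" and B: "tight_frame {1..M} (f i0) (W i0) B"
    using assms(5) by blast
  obtain U where U: "\<And>i. i \<in> {1..L} \<Longrightarrow> coisometry (U i)"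
    and fU: "\<And>i j. i \<in> {1..L} \<Longrightarrow> j \<in> {1..M} \<Longrightarrow> f i j = U i (f i0 j)"
    using assms(6) by blast
  obtain A where A_pos: "\<And>j. j \<in> {1..M} \<Longrightarrow> A j > 0"
    and A: "\<And>j. j \<in> {1..M} \<Longrightarrow> tight_frame {1..L} (\<lambda>i. f i j) UNIV (A j)"
    using assms(7) by metis
  have frame: "tight_frame {1..M} (\<lambda>j. U i (f i0 j)) (W i) B" if i: "i \<in> {1..L}" for i
  proof -
    \<comment> \<open>Linear maps commute with spans, so it suffices to compare generators.\<close>
    have "f i ` {1..M} = U i ` f i0 ` {1..M}"
      using fU[OF i] by (simp add: image_image)
    then have "W i = U i ` W i0"
      using assms(3) i \<open>i0 \<in> {1..L}\<close> vec.linear_span_image[OF coisometry_linear[OF U[OF i]]]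
      by simp
    then show ?thesis
      using tight_frame_coisometry[OF B U[OF i]] by simp
  qed
  have proj: "(\<Sum>j=1..M. (cmod (hinner x (f i j)))\<^sup>2) = B * (norm (orth_proj (W i) x))\<^sup>2"
    if i: "i \<in> {1..L}" for i x
    using tight_frame_orth_proj[OF frame[OF i]] fU[OF i] by simp
  have "(\<Sum>i=1..L. (norm (orth_proj (W i) x))\<^sup>2) = (\<Sum>j=1..M. A j) / B * (norm x)\<^sup>2" for x
  proof -
    have "B * (\<Sum>i=1..L. (norm (orth_proj (W i) x))\<^sup>2)
        = (\<Sum>i=1..L. \<Sum>j=1..M. (cmod (hinner x (f i j)))\<^sup>2)"
      unfolding sum_distrib_left by (intro sum.cong refl) (simp only: proj)
    also have "\<dots> = (\<Sum>j=1..M. \<Sum>i=1..L. (cmod (hinner x (f i j)))\<^sup>2)"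
      by (rule sum.swap)
    \<comment> \<open>With \<open>j\<close> fixed, the sum over \<open>i\<close> is the frame sum
      for the whole space.\<close>
    also have "\<dots> = (\<Sum>j=1..M. A j * (norm x)\<^sup>2)"
      using A by (intro sum.cong) (auto simp: tight_frame_def)
    finally show ?thesis
      using \<open>B > 0\<close> by (simp add: sum_distrib_right field_simps)
  qed
  \<comment> \<open>Strict positivity comes from \<open>M \<ge> 1\<close>: the sum of the positive
    \<open>A j\<close> is nonempty.\<close>
  moreover have "(\<Sum>j=1..M. A j) / B > 0"
    using \<open>B > 0\<close> \<open>M \<ge> 1\<close> A_pos by (intro divide_pos_pos sum_pos) auto
  moreover have "vec.subspace (W i)" if "i \<in> {1..L}" for i
    using frame[OF that] by (simp add: tight_frame_def)
  ultimately show ?thesis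
    unfolding tight_fusion_frame_def by blast
qed

end
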